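(* Let $X=\{X(n)\}_{n\ge0}$ be the vertex occupation process and $\pi$ the transition map described in the context. Let $p\in\partial\mathcal D$ be such that for some $i\in[m]$ and $k\in V^i$, $$p_k^i=0\quad\text{and}\quad \lim_{x\to p}\frac{\pi_k^i(x)}{x_k^i}>1$$ (limit over $x\in\mathcal D$ with $x_k^i>0$). Then $\mathbb P\big(\lim_{n\to\infty}X(n)=p\big)=0$.
   Context: Model. Let $m\ge1$, $[m]=\{1,\dots,m\}$, let $V^1,\dots,V^m$ be nonempty finite sets, $V=\bigcup_i V^i$, $d^i=|V^i|$, and $I_v=\{i\in[m]: v\in V^i\}$ for $v\in V$. Parameters: $\alpha>0$, $\eta_v^i>0$ ($v\in V$, $i\in I_v$), $\rho_v^{ij}\in\mathbb R$ ($v\in V$, $i,j\in I_v$) with $\rho_v^{ij}=\rho_v^{ji}$ and $\eta_v^i>\sum_{j\in I_v:\rho_v^{ij}<0}|\rho_v^{ij}|$. Let $\triangle^i$ be the simplex of probability vectors $(x_v^i)_{v\in V^i}$ and $\mathcal D=\triangle^1\times\cdots\times\triangle^m$, with points $x=(x_v^i)_{i\in[m],v\in V^i}$. Let $\mathcal D^\circ=\{x\in\mathcal D: x_v^i>0\ \forall i\in[m],v\in V^i\}$ and $\partial\mathcal D=\mathcal D\setminus\mathcal D^\circ$. Define $\pi=(\pi_v^i)_{i\in[m],v\in V^i}:\mathcal D\to\mathcal D$ by $$\pi_v^i(x)=\frac{x_v^iH_v^i(x)}{\sum_{w\in V^i}x_w^iH_w^i(x)},\qquad H_v^i(x)=\Big(\eta_v^i+\sum_{j\in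 I_v}\rho_v^{ij}x_v^j\Big)^\alpha .$$ The walks $W^i(n)\in V^i$, $n\ge1$, $i\in[m]$, are random variables on a probability space such that, with $X_v^i(0)=1/d^i$, $X_v^i(n)=\frac{1}{d^i+n}\big(1+\sum_{k=1}^n\mathbf 1\{W^i(k)=v\}\big)$, $X(n)=(X_v^i(n))_{i,v}\in\mathcal D$, and $\mathcal F_n$ the $\sigma$-field generated by $W^i(k)$, $i\in[m]$, $1\le k\le n$ ($\mathcal F_0$ trivial), one has $\mathbb P(W^i(n+1)=v\mid\mathcal F_n)=\pi_v^i(X(n))$ for all $n\ge0$, and $W^1(n+1),\dots,W^m(n+1)$ are conditionally independent given $\mathcal F_n$. *)

theory Defs
  imports "HOL-Probability.Probability"
begin

text \<open>
  A point \<open>x\<close> with coordinates \<open>x\<^sub>v\<^sup>i\<close> is a function with \<open>x i v\<close> for that coordinate.  Coordinates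
  outside the index set \<open>{(i, v). i \<in> {1..m} \<and> v \<in> V i}\<close> are fixed to be 0; on such functions the
  product topology of \<^typ>\<open>nat \<Rightarrow> 'v \<Rightarrow> real\<close> is the Euclidean topology of the finitely many
  remaining coordinates.  Likewise \<open>\<eta> i v\<close> and \<open>\<rho> i j v\<close> stand for \<open>\<eta>\<^sub>v\<^sup>i\<close> and \<open>\<rho>\<^sub>v\<^sup>i\<^sup>j\<close>.
\<close>

definition domain_D :: "nat \<Rightarrow> (nat \<Rightarrow> 'v set) \<Rightarrow> (nat \<Rightarrow> 'v \<Rightarrow> real) set" where
  "domain_D m V = {x. (\<forall>i\<in>{1..m}. (\<forall>v\<in>V i. 0 \<le> x i v) \<and> (\<Sum>v\<in>V i. x i v) = 1)
                    \<and> (\<forall>i v. \<not> (i \<in> {1..m} \<and> v \<in> V i) \<longrightarrow> x i v = 0)}"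

definition interior_D :: "nat \<Rightarrow> (nat \<Rightarrow> 'v set) \<Rightarrow> (nat \<Rightarrow> 'v \<Rightarrow> real) set" where
  "interior_D m V = {x \<in> domain_D m V. \<forall>i\<in>{1..m}. \<forall>v\<in>V i. 0 < x i v}"

definition boundary_D :: "nat \<Rightarrow> (nat \<Rightarrow> 'v set) \<Rightarrow> (nat \<Rightarrow> 'v \<Rightarrow> real) set" where
  "boundary_D m V = domain_D m V - interior_D m V"

definition walks_at :: "nat \<Rightarrow> (nat \<Rightarrow> 'v set) \<Rightarrow> 'v \<Rightarrow> nat set" where
  "walks_at m V v = {i \<in> {1..m}. v \<in> V i}"

definition weight_H ::
    "nat \<Rightarrow> (nat \<Rightarrow> 'v set) \<Rightarrow> real \<Rightarrow> (nat \<Rightarrow> 'v \<Rightarrow> real) \<Rightarrow> (nat \<Rightarrow> nat \<Rightarrow> 'v \<Rightarrow> real)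
      \<Rightarrow> (nat \<Rightarrow> 'v \<Rightarrow> real) \<Rightarrow> nat \<Rightarrow> 'v \<Rightarrow> real" where
  "weight_H m V \<alpha> \<eta> \<rho> x i v = (\<eta> i v + (\<Sum>j\<in>walks_at m V v. \<rho> i j v * x j v)) powr \<alpha>"

text \<open>For \<open>x\<close> in the domain the right-hand side is 0 outside the index set, because \<open>x i v = 0\<close> there.\<close>

definition trans_pi ::
    "nat \<Rightarrow> (nat \<Rightarrow> 'v set) \<Rightarrow> real \<Rightarrow> (nat \<Rightarrow> 'v \<Rightarrow> real) \<Rightarrow> (nat \<Rightarrow> nat \<Rightarrow> 'v \<Rightarrow> real)
      \<Rightarrow> (nat \<Rightarrow> 'v \<Rightarrow> real) \<Rightarrow> nat \<Rightarrow> 'v \<Rightarrow> real" where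
  "trans_pi m V \<alpha> \<eta> \<rho> x i v =
     x i v * weight_H m V \<alpha> \<eta> \<rho> x i v / (\<Sum>w\<in>V i. x i w * weight_H m V \<alpha> \<eta> \<rho> x i w)"

definition occupation ::
    "nat \<Rightarrow> (nat \<Rightarrow> 'v set) \<Rightarrow> (nat \<Rightarrow> nat \<Rightarrow> 'w \<Rightarrow> 'v) \<Rightarrow> nat \<Rightarrow> 'w \<Rightarrow> nat \<Rightarrow> 'v \<Rightarrow> real" where
  "occupation m V W n \<omega> i v =
     (if i \<in> {1..m} \<and> v \<in> V i
      then (1 + (\<Sum>k=1..n. of_bool (W i k \<omega> = v))) / (real (card (V i)) + real n) else 0)"

definition walk_filtration ::
    "'w measure \<Rightarrow> nat \<Rightarrow> (nat \<Rightarrow> 'v set) \<Rightarrow> (nat \<Rightarrow> nat \<Rightarrow> 'w \<Rightarrow> 'v) \<Rightarrow> nat \<Rightarrow> 'w measure" where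
  "walk_filtration M m V W n =
     sigma (space M) {W i k -` A \<inter> space M | i k A. i \<in> {1..m} \<and> k \<in> {1..n} \<and> A \<subseteq> V i}"

definition cond_prob_given :: "'w measure \<Rightarrow> 'w measure \<Rightarrow> 'w set \<Rightarrow> 'w \<Rightarrow> real" where
  "cond_prob_given M F A = real_cond_exp M F (indicator A)"

definition cond_indep_vars_given ::
    "'w measure \<Rightarrow> 'w measure \<Rightarrow> ('i \<Rightarrow> 'a measure) \<Rightarrow> ('i \<Rightarrow> 'w \<Rightarrow> 'a) \<Rightarrow> 'i set \<Rightarrow> bool" where
  "cond_indep_vars_given M F N Y I \<longleftrightarrow>
     (\<forall>i\<in>I. Y i \<in> measurable M (N i)) \<and>
     (\<forall>J A. J \<subseteq> I \<longrightarrow> J \<noteq> {} \<longrightarrow> finite J \<longrightarrow> (\<forall>i\<in>J. A i \<in> sets (N i)) \<longrightarrow>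
        (AE \<omega> in M. cond_prob_given M F (\<Inter>i\<in>J. Y i -` A i \<inter> space M) \<omega>
                   = (\<Prod>i\<in>J. cond_prob_given M F (Y i -` A i \<inter> space M) \<omega>)))"

text \<open>Only the values \<open>W i n\<close> with \<open>i \<in> {1..m}\<close> and \<open>n \<ge> 1\<close> are meaningful.\<close>

locale interacting_walks = prob_space M
  for M :: "'w measure" +
  fixes m :: nat
    and V :: "nat \<Rightarrow> 'v set"
    and \<alpha> :: real
    and \<eta> :: "nat \<Rightarrow> 'v \<Rightarrow> real"
    and \<rho> :: "nat \<Rightarrow> nat \<Rightarrow> 'v \<Rightarrow> real"
    and W :: "nat \<Rightarrow> nat \<Rightarrow> 'w \<Rightarrow> 'v"
  assumes m_ge_1: "1 \<le> m"
    and finite_V: "\<And>i. i \<in> {1..m} \<Longrightarrow> finite (V i)"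
    and nonempty_V: "\<And>i. i \<in> {1..m} \<Longrightarrow> V i \<noteq> {}"
    and alpha_pos: "0 < \<alpha>"
    and eta_pos: "\<And>i v. i \<in> {1..m} \<Longrightarrow> v \<in> V i \<Longrightarrow> 0 < \<eta> i v"
    and rho_sym: "\<And>v i j. i \<in> walks_at m V v \<Longrightarrow> j \<in> walks_at m V v \<Longrightarrow> \<rho> i j v = \<rho> j i v"
    and eta_dominates: "\<And>i v. i \<in> {1..m} \<Longrightarrow> v \<in> V i \<Longrightarrow>
          (\<Sum>j \<in> {j \<in> walks_at m V v. \<rho> i j v < 0}. \<bar>\<rho> i j v\<bar>) < \<eta> i v"
    and W_measurable: "\<And>i n. i \<in> {1..m} \<Longrightarrow> 1 \<le> n \<Longrightarrow> W i n \<in> measurable M (count_space (V i))"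
    and W_transition: "\<And>i v n. i \<in> {1..m} \<Longrightarrow> v \<in> V i \<Longrightarrow>
          (AE \<omega> in M. cond_prob_given M (walk_filtration M m V W n)
                         (W i (Suc n) -` {v} \<inter> space M) \<omega>
                     = trans_pi m V \<alpha> \<eta> \<rho> (occupation m V W n \<omega>) i v)"
    and W_cond_indep: "\<And>n. cond_indep_vars_given M (walk_filtration M m V W n)
                         (\<lambda>i. count_space (V i)) (\<lambda>i. W i (Suc n)) {1..m}"

end

theory Submission
  imports Defs
begin

text \<open>
  Let \<open>S\<^sub>n\<close> be the number of visits of walk \<open>i\<close> to \<open>k\<close> up to time \<open>n\<close>, and let \<open>d\<close> be the size of
  \<open>V i\<close>.  Choose \<open>\<epsilon> > 0\<close> with \<open>(1 + \<epsilon>)\<^sup>2 < L\<close>.  Where \<open>X(n)\<close> converges to \<open>p\<close>, from some time \<open>N\<close> on the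
  probability of a visit is at least \<open>(1 + \<epsilon>)\<^sup>2\<close> times \<open>(1 + S\<^sub>n) / (d + n)\<close>.  As long as this bound has
  held since time \<open>N\<close>, the expectation of \<open>(d + n) / (S\<^sub>n + \<epsilon>)\<close> contracts by the factor
  \<open>1 - \<epsilon> / (d + n)\<close> in each step.  These factors multiply to 0, whereas \<open>(d + n) / (S\<^sub>n + \<epsilon>)\<close> is
  bounded below; so almost surely the bound fails at some time after \<open>N\<close>.
\<close>

section \<open>Coordinatewise convergence and measurability of limit events\<close>

lemma tendsto_fun_iff:
  fixes f :: "'a \<Rightarrow> 'b \<Rightarrow> 'c::topological_space"
  shows "(f \<longlongrightarrow> l) F \<longleftrightarrow> (\<forall>i. ((\<lambda>x. f x i) \<longlongrightarrow> l i) F)"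
proof -
  have "(f \<longlongrightarrow> l) F \<longleftrightarrow> limitin (product_topology (\<lambda>_. euclidean) UNIV) f l F"
    by (simp add: euclidean_product_topology)
  then show ?thesis
    by (simp add: limitin_componentwise)
qed

text \<open>Testing convergence only against the tolerances \<open>1 / (K + 1)\<close> turns it into
  countably many unions and intersections of measurable conditions.\<close>

lemma sets_Collect_LIMSEQ_real:
  fixes f :: "nat \<Rightarrow> 'a \<Rightarrow> real"
  assumes [measurable]: "\<And>n. f n \<in> borel_measurable M"
  shows "{x \<in> space M. (\<lambda>n. f n x) \<longlonglongrightarrow> l} \<in> sets M"
proof -
  have eq: "(\<lambda>n. f n x) \<longlonglongrightarrow> l \<longleftrightarrow> (\<forall>K. \<exists>N. \<forall>n\<ge>N. dist (f n x) l < inverse (real (Suc K)))" for x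
  proof
    assume "(\<lambda>n. f n x) \<longlonglongrightarrow> l"
    then show "\<forall>K. \<exists>N. \<forall>n\<ge>N. dist (f n x) l < inverse (real (Suc K))"
      unfolding lim_sequentially by simp
  next
    assume *: "\<forall>K. \<exists>N. \<forall>n\<ge>N. dist (f n x) l < inverse (real (Suc K))"
    show "(\<lambda>n. f n x) \<longlonglongrightarrow> l"
      unfolding lim_sequentially
    proof (intro allI impI)
      fix r :: real assume "0 < r"
      then obtain K where "inverse (real (Suc K)) < r"
        using reals_Archimedean by blast
      with * show "\<exists>N. \<forall>n\<ge>N. dist (f n x) l < r"
        by (meson order_less_trans)
    qed
  qed
  show ?thesis
    unfolding eq by measurable
qed

section \<open>Deterministic inequalities: the harmonic product and the one-step drift\<close>

text \<open>The factor \<open>1 - \<epsilon> / D\<close> is at most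
  \<open>(D / (D + 1)) powr \<epsilon>\<close>, so from time \<open>N\<close> on
  \<open>e n * (d + n) powr \<epsilon>\<close> cannot increase, and \<open>e n\<close> decays at
  least like \<open>(d + n) powr - \<epsilon>\<close>.\<close>

lemma tendsto_0_of_harmonic_contraction:
  fixes e :: "nat \<Rightarrow> real"
  assumes "0 < \<epsilon>" and "0 < d" and nonneg: "\<And>n. 0 \<le> e n"
    and step: "\<And>n. N \<le> n \<Longrightarrow> e (Suc n) \<le> (1 - \<epsilon> / (d + real n)) * e n"
  shows "e \<longlonglongrightarrow> 0"
proof -
  \<comment> \<open>This covers \<open>D < \<epsilon>\<close> as well, where the factor is negative:
    \<open>1 + x \<le> exp x\<close> holds for every real \<open>x\<close>.\<close>
  have contraction: "(1 - \<epsilon> / D) * (D + 1) powr \<epsilon> \<le> D powr \<epsilon>" if "0 < D" for D :: real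
  proof -
    have "ln ((D + 1) / D) \<le> 1 / D"
      using ln_add_one_self_le_self[of "1 / D"] that by (simp add: field_simps)
    then have "\<epsilon> * (ln (D + 1) - ln D) \<le> \<epsilon> * (1 / D)"
      using that \<open>0 < \<epsilon>\<close> by (intro mult_left_mono) (auto simp: ln_div)
    then have *: "- (\<epsilon> / D) + \<epsilon> * ln (D + 1) \<le> \<epsilon> * ln D"
      by (simp add: algebra_simps)
    have "1 - \<epsilon> / D \<le> exp (- (\<epsilon> / D))"
      using exp_ge_add_one_self[of "- (\<epsilon> / D)"] by simp
    then have "(1 - \<epsilon> / D) * (D + 1) powr \<epsilon> \<le> exp (- (\<epsilon> / D)) * (D + 1) powr \<epsilon>"
      by (intro mult_right_mono) auto
    also have "\<dots> = exp (- (\<epsilon> / D) + \<epsilon> * ln (D + 1))"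
      using that by (simp add: powr_def mult_exp_exp)
    also have "\<dots> \<le> D powr \<epsilon>"
      using that * by (simp add: powr_def)
    finally show ?thesis .
  qed
  define C where "C = e N * (d + real N) powr \<epsilon>"
  have bound: "e n * (d + real n) powr \<epsilon> \<le> C" if "N \<le> n" for n
    using that
  proof (induction n rule: dec_induct)
    case base
    show ?case by (simp add: C_def)
  next
    case (step n)
    have "e (Suc n) * (d + real n + 1) powr \<epsilon>
        \<le> (1 - \<epsilon> / (d + real n)) * e n * (d + real n + 1) powr \<epsilon>"
      using assms(4)[OF step(1)] by (intro mult_right_mono) auto
    also have "\<dots> = e n * ((1 - \<epsilon> / (d + real n)) * (d + real n + 1) powr \<epsilon>)"
      by simp
    also have "\<dots> \<le> e n * (d + real n) powr \<epsilon>"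
      using nonneg \<open>0 < d\<close> by (intro mult_left_mono contraction) auto
    also have "\<dots> \<le> C"
      by (rule step.IH)
    finally show ?case by (simp add: add_ac)
  qed
  have "filterlim (\<lambda>n. d + real n) at_top sequentially"
    by (intro filterlim_tendsto_add_at_top[OF tendsto_const] filterlim_real_sequentially)
  then have "(\<lambda>n. (d + real n) powr - \<epsilon>) \<longlonglongrightarrow> 0"
    using \<open>0 < \<epsilon>\<close> by (intro tendsto_neg_powr) auto
  then have upper_lim: "(\<lambda>n. C * (d + real n) powr - \<epsilon>) \<longlonglongrightarrow> 0"
    by (rule tendsto_mult_right_zero)
  have upper: "\<forall>\<^sub>F n in sequentially. e n \<le> C * (d + real n) powr - \<epsilon>"
    using eventually_ge_at_top[of N]
  proof eventually_elim
    case (elim n)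
    have "0 < (d + real n) powr \<epsilon>" using \<open>0 < d\<close> by simp
    with bound[OF elim] show ?case
      by (simp add: powr_minus field_simps)
  qed
  show ?thesis
    by (rule tendsto_sandwich[OF always_eventually upper tendsto_const upper_lim])
      (simp add: nonneg)
qed

text \<open>The weight \<open>1 / (s + \<epsilon>)\<close> of \<open>s\<close> earlier visits is chosen so that this holds already at \<open>s = 0\<close>;
  the weight \<open>1 / (s + 1)\<close> would require \<open>s\<close> to be large.\<close>

lemma visit_drift:
  fixes D s q \<epsilon> :: real
  assumes "0 < \<epsilon>" "0 < D" "0 \<le> s" and q: "(1 + \<epsilon>)\<^sup>2 * ((1 + s) / D) \<le> q"
  shows "(D + 1) / (s + \<epsilon>) + ((D + 1) / (s + 1 + \<epsilon>) - (D + 1) / (s + \<epsilon>)) * q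
         \<le> (1 - \<epsilon> / D) * (D / (s + \<epsilon>))"
proof -
  \<comment> \<open>One of the two factors \<open>1 + \<epsilon>\<close> in the hypothesis pays for
    replacing \<open>1 + s\<close> by \<open>1 + s + \<epsilon>\<close>; the other survives as the
    drift.\<close>
  have "1 + s + \<epsilon> \<le> (1 + \<epsilon>) * (1 + s)"
    using assms by (simp add: algebra_simps)
  then have "(1 + \<epsilon>) * (1 + s + \<epsilon>) \<le> (1 + \<epsilon>)\<^sup>2 * (1 + s)"
    unfolding power2_eq_square mult.assoc using assms by (intro mult_left_mono) auto
  moreover have "(1 + \<epsilon>)\<^sup>2 * (1 + s) \<le> q * D"
    using q assms by (simp add: field_simps)
  ultimately have "(1 + \<epsilon>) * (1 + s + \<epsilon>) \<le> q * D"
    by linarith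
  then have "(1 + \<epsilon>) / D \<le> q / (s + 1 + \<epsilon>)"
    using assms by (simp add: field_simps)
  then have "(D + 1) * (1 - q / (s + 1 + \<epsilon>)) \<le> (D + 1) * (1 - (1 + \<epsilon>) / D)"
    using assms by (intro mult_left_mono) auto
  \<comment> \<open>The left side equals
    \<open>D - \<epsilon> - (1 + \<epsilon>) / D\<close>.\<close>
  also have "\<dots> \<le> D - \<epsilon>"
    using assms by (simp add: field_simps)
  finally have "(D + 1) * (1 - q / (s + 1 + \<epsilon>)) / (s + \<epsilon>) \<le> (D - \<epsilon>) / (s + \<epsilon>)"
    using assms by (intro divide_right_mono) auto
  moreover have "(D + 1) / (s + \<epsilon>) + ((D + 1) / (s + 1 + \<epsilon>) - (D + 1) / (s + \<epsilon>)) * q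
      = (D + 1) * (1 - q / (s + 1 + \<epsilon>)) / (s + \<epsilon>)"
  proof -
    have nz: "s + \<epsilon> \<noteq> 0" "s + 1 + \<epsilon> \<noteq> 0" using assms by auto
    have "(D + 1) / (s + 1 + \<epsilon>) - (D + 1) / (s + \<epsilon>) = - ((D + 1) / ((s + \<epsilon>) * (s + 1 + \<epsilon>)))"
      using nz by (simp add: divide_simps) (simp add: algebra_simps)
    moreover have "E / a + - (E / (a * b)) * q = E * (1 - q / b) / a" for E a b :: real
      by (simp add: right_diff_distrib diff_divide_distrib mult.commute)
    ultimately show ?thesis by metis
  qed
  moreover have "(1 - \<epsilon> / D) * (D / (s + \<epsilon>)) = (D - \<epsilon>) / (s + \<epsilon>)"
  proof -
    have "(1 - \<epsilon> / D) * D = D - \<epsilon>" using \<open>0 < D\<close> by (simp add: left_diff_distrib)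
    then show ?thesis by (metis times_divide_eq_right)
  qed
  ultimately show ?thesis by metis
qed

section \<open>Filtration, visit counts and occupation measures\<close>

context interacting_walks
begin

abbreviation filt :: "nat \<Rightarrow> 'w measure" where
  "filt \<equiv> walk_filtration M m V W"

abbreviation occ :: "nat \<Rightarrow> 'w \<Rightarrow> nat \<Rightarrow> 'v \<Rightarrow> real" where
  "occ \<equiv> occupation m V W"

abbreviation trans :: "(nat \<Rightarrow> 'v \<Rightarrow> real) \<Rightarrow> nat \<Rightarrow> 'v \<Rightarrow> real" where
  "trans \<equiv> trans_pi m V \<alpha> \<eta> \<rho>"

definition visits :: "nat \<Rightarrow> 'v \<Rightarrow> nat \<Rightarrow> 'w \<Rightarrow> real" where
  "visits i v n \<omega> = (\<Sum>k=1..n. of_bool (W i k \<omega> = v))"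

text \<open>The finite horizon \<open>n\<close> keeps the event in \<open>filt n\<close>, so that
  its indicator can be pulled out of a conditional expectation given the past. For
  \<open>n < N\<close> the event is the whole space, so intersecting over all \<open>n\<close>
  leaves exactly the bound at all times from \<open>N\<close> on.\<close>

definition drift_event :: "nat \<Rightarrow> 'v \<Rightarrow> real \<Rightarrow> nat \<Rightarrow> nat \<Rightarrow> 'w set" where
  "drift_event i v c N n = {\<omega> \<in> space M. \<forall>j\<in>{N..n}. c * occ j \<omega> i v \<le> trans (occ j \<omega>) i v}"

lemma W_in_V: "i \<in> {1..m} \<Longrightarrow> 1 \<le> n \<Longrightarrow> \<omega> \<in> space M \<Longrightarrow> W i n \<omega> \<in> V i"
  using measurable_space[OF W_measurable] by simp

lemma space_filt [simp]: "space (filt n) = space M"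
  by (simp add: walk_filtration_def space_measure_of_conv)

lemma sets_filt:
  "sets (filt n) = sigma_sets (space M)
     {W i k -` A \<inter> space M | i k A. i \<in> {1..m} \<and> k \<in> {1..n} \<and> A \<subseteq> V i}"
  unfolding walk_filtration_def by (rule sets_measure_of) auto

lemma subalgebra_filt: "subalgebra M (filt n)"
proof -
  have "{W i k -` A \<inter> space M | i k A. i \<in> {1..m} \<and> k \<in> {1..n} \<and> A \<subseteq> V i} \<subseteq> sets M"
    using measurable_sets[OF W_measurable] by auto
  then show ?thesis
    unfolding subalgebra_def sets_filt by (simp add: sets.sigma_sets_subset)
qed

sublocale filt: finite_measure_subalgebra M "filt n" for n
  by unfold_locales (rule subalgebra_filt)

lemma walk_event_filt:
  assumes "i \<in> {1..m}" "v \<in> V i" "1 \<le> j" "j \<le> n"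
  shows "{\<omega> \<in> space M. W i j \<omega> = v} \<in> sets (filt n)"
proof -
  have "{\<omega> \<in> space M. W i j \<omega> = v} = W i j -` {v} \<inter> space M"
    by auto
  also have "\<dots> \<in> sets (filt n)"
    unfolding sets_filt
    by (intro sigma_sets.Basic CollectI exI[of _ i] exI[of _ j] exI[of _ "{v}"]) (use assms in auto)
  finally show ?thesis .
qed

lemma visits_measurable_filt:
  assumes "i \<in> {1..m}" "v \<in> V i" "j \<le> n"
  shows "visits i v j \<in> borel_measurable (filt n)"
  unfolding visits_def
proof (rule borel_measurable_sum)
  fix k assume "k \<in> {1..j}"
  then have "{\<omega> \<in> space M. W i k \<omega> = v} \<in> sets (filt n)"
    using assms by (intro walk_event_filt) auto
  then have [measurable]: "Measurable.pred (filt n) (\<lambda>\<omega>. W i k \<omega> = v)"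
    by (simp add: pred_def)
  show "(\<lambda>\<omega>. of_bool (W i k \<omega> = v) :: real) \<in> borel_measurable (filt n)"
    by measurable
qed

lemma occ_eq_visits:
  "i \<in> {1..m} \<Longrightarrow> v \<in> V i \<Longrightarrow>
     occ n \<omega> i v = (1 + visits i v n \<omega>) / (real (card (V i)) + real n)"
  by (simp add: occupation_def visits_def)

lemma occ_outside: "\<not> (i \<in> {1..m} \<and> v \<in> V i) \<Longrightarrow> occ n \<omega> i v = 0"
  unfolding occupation_def by (rule if_not_P)

lemma occ_measurable_filt:
  assumes "j \<le> n"
  shows "(\<lambda>\<omega>. occ j \<omega> i v) \<in> borel_measurable (filt n)"
proof (cases "i \<in> {1..m} \<and> v \<in> V i")
  case True
  then have [measurable]: "visits i v j \<in> borel_measurable (filt n)"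
    using assms by (intro visits_measurable_filt) auto
  show ?thesis
    using True by (simp add: occ_eq_visits)
next
  case False
  then show ?thesis by (simp only: occ_outside[OF False] measurable_const) simp
qed

lemma trans_occ_measurable_filt:
  assumes "j \<le> n"
  shows "(\<lambda>\<omega>. trans (occ j \<omega>) i v) \<in> borel_measurable (filt n)"
proof -
  note [measurable] = occ_measurable_filt[OF assms]
  show ?thesis
    unfolding trans_pi_def weight_H_def by measurable
qed

lemma drift_event_filt: "drift_event i v c N n \<in> sets (filt n)"
proof -
  have "{\<omega> \<in> space (filt n). c * occ j \<omega> i v \<le> trans (occ j \<omega>) i v} \<in> sets (filt n)"
    if "j \<le> n" for j
    by (intro borel_measurable_le borel_measurable_times borel_measurable_const
        occ_measurable_filt trans_occ_measurable_filt that)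
  then have "{\<omega> \<in> space (filt n). \<forall>j\<in>{N..n}. c * occ j \<omega> i v \<le> trans (occ j \<omega>) i v}
      \<in> sets (filt n)"
    by (intro sets.sets_Collect_finite_All) auto
  then show ?thesis
    by (simp add: drift_event_def)
qed

lemma card_V_pos: "i \<in> {1..m} \<Longrightarrow> 0 < card (V i)"
  using finite_V nonempty_V by (simp add: card_gt_0_iff)

lemma visits_nonneg: "0 \<le> visits i v n \<omega>"
  by (simp add: visits_def sum_nonneg)

lemma visits_le: "visits i v n \<omega> \<le> real n"
proof -
  have "visits i v n \<omega> \<le> (\<Sum>k=1..n. 1)"
    unfolding visits_def by (intro sum_mono) auto
  then show ?thesis by simp
qed

lemma visits_Suc: "visits i v (Suc n) \<omega> = visits i v n \<omega> + of_bool (W i (Suc n) \<omega> = v)"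
  by (simp add: visits_def)

text \<open>The initial 1 in the count keeps every coordinate positive, so the process stays in the
  set along which the limit at \<open>p\<close> is taken.\<close>

lemma occ_pos:
  assumes "i \<in> {1..m}" "v \<in> V i"
  shows "0 < occ n \<omega> i v"
  using assms card_V_pos[of i] visits_nonneg[of i v n \<omega>]
  by (auto simp: occ_eq_visits intro!: divide_pos_pos add_pos_nonneg)

text \<open>At each time walk \<open>i\<close> visits exactly one vertex of \<open>V i\<close>, so
  the visits add up to \<open>n\<close>; the initial ones contribute
  \<open>card (V i)\<close>.\<close>

lemma occ_in_domain:
  assumes "\<omega> \<in> space M"
  shows "occ n \<omega> \<in> domain_D m V"
proof -
  have "(\<Sum>v\<in>V i. occ n \<omega> i v) = 1" if i: "i \<in> {1..m}" for i
  proof -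
    have "(\<Sum>v\<in>V i. visits i v n \<omega>) = (\<Sum>k=1..n. \<Sum>v\<in>V i. of_bool (W i k \<omega> = v))"
      unfolding visits_def by (rule sum.swap)
    also have "\<dots> = (\<Sum>k=1..n. 1)"
    proof (rule sum.cong[OF refl])
      fix k assume "k \<in> {1..n}"
      then have "W i k \<omega> \<in> V i" using W_in_V[OF i _ assms] by simp
      then show "(\<Sum>v\<in>V i. of_bool (W i k \<omega> = v)) = (1::real)"
        using finite_V[OF i] by (simp add: of_bool_def sum.delta)
    qed
    finally have "(\<Sum>v\<in>V i. visits i v n \<omega>) = real n" by simp
    moreover have "(\<Sum>v\<in>V i. occ n \<omega> i v)
        = (\<Sum>v\<in>V i. 1 + visits i v n \<omega>) / (real (card (V i)) + real n)"
      using i by (simp add: occ_eq_visits sum_divide_distrib)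
    ultimately show ?thesis
      using card_V_pos[OF i] by (simp add: sum.distrib)
  qed
  then show ?thesis
    unfolding domain_D_def using occ_outside occ_pos by (auto intro: less_imp_le)
qed

section \<open>Expected weights and the drift event\<close>

text \<open>By \<open>W_transition\<close>, \<open>trans (occ n \<omega>) i v\<close> is a version
  of the conditional probability of a visit at time \<open>n + 1\<close>, and a bounded factor known
  at time \<open>n\<close> can be pulled out.\<close>

lemma integral_filt_walk:
  assumes i: "i \<in> {1..m}" "v \<in> V i"
    and f [measurable]: "f \<in> borel_measurable (filt n)" and bounded: "\<And>\<omega>. \<bar>f \<omega>\<bar> \<le> B"
  shows "integrable M (\<lambda>\<omega>. f \<omega> * of_bool (W i (Suc n) \<omega> = v))"
    and "integrable M (\<lambda>\<omega>. f \<omega> * trans (occ n \<omega>) i v)"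
    and "(\<integral>\<omega>. f \<omega> * of_bool (W i (Suc n) \<omega> = v) \<partial>M) = (\<integral>\<omega>. f \<omega> * trans (occ n \<omega>) i v \<partial>M)"
proof -
  let ?A = "W i (Suc n) -` {v} \<inter> space M"
  have A [measurable]: "?A \<in> sets M"
    using measurable_sets[OF W_measurable[OF i(1), of "Suc n"], of "{v}"] i by simp
  have [measurable]: "f \<in> borel_measurable M"
    by (rule measurable_from_subalg[OF subalgebra_filt f])
  have [measurable]: "(\<lambda>\<omega>. trans (occ n \<omega>) i v) \<in> borel_measurable M"
    by (rule measurable_from_subalg[OF subalgebra_filt trans_occ_measurable_filt[OF order_refl]])
  \<comment> \<open>Any sample point serves here, since \<open>bounded\<close> is assumed for all of
    them.\<close>
  have "0 \<le> B"
    using bounded[of undefined] by linarith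
  have int: "integrable M (\<lambda>\<omega>. f \<omega> * indicator ?A \<omega>)"
  proof (rule integrable_const_bound[where B = B])
    show "AE \<omega> in M. norm (f \<omega> * indicator ?A \<omega>) \<le> B"
      using bounded \<open>0 \<le> B\<close> by (simp add: indicator_def)
  qed measurable
  have eq: "f \<omega> * indicator ?A \<omega> = f \<omega> * of_bool (W i (Suc n) \<omega> = v)" if "\<omega> \<in> space M" for \<omega>
    using that by (simp add: indicator_def)
  have ae: "AE \<omega> in M. f \<omega> * real_cond_exp M (filt n) (indicator ?A) \<omega> = f \<omega> * trans (occ n \<omega>) i v"
    using W_transition[OF i, of n] by (auto simp: cond_prob_given_def)
  note cond = filt.real_cond_exp_intg[OF int f borel_measurable_indicator[OF A]]
  show "integrable M (\<lambda>\<omega>. f \<omega> * of_bool (W i (Suc n) \<omega> = v))"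
    using int by (simp cong: Bochner_Integration.integrable_cong add: eq)
  show "integrable M (\<lambda>\<omega>. f \<omega> * trans (occ n \<omega>) i v)"
    by (rule integrable_cong_AE_imp[OF cond(1)]) (use ae in \<open>auto elim: AE_mp\<close>)
  have "(\<integral>\<omega>. f \<omega> * of_bool (W i (Suc n) \<omega> = v) \<partial>M) = (\<integral>\<omega>. f \<omega> * indicator ?A \<omega> \<partial>M)"
    by (intro Bochner_Integration.integral_cong) (simp_all add: eq)
  also have "\<dots> = (\<integral>\<omega>. f \<omega> * real_cond_exp M (filt n) (indicator ?A) \<omega> \<partial>M)"
    by (rule cond(2)[symmetric])
  also have "\<dots> = (\<integral>\<omega>. f \<omega> * trans (occ n \<omega>) i v \<partial>M)"
    by (rule integral_cong_AE[OF _ _ ae]) measurable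
  finally show "(\<integral>\<omega>. f \<omega> * of_bool (W i (Suc n) \<omega> = v) \<partial>M) = (\<integral>\<omega>. f \<omega> * trans (occ n \<omega>) i v \<partial>M)" .
qed

text \<open>On the event up to time \<open>n\<close> the visit probability is large enough for
  \<open>visit_drift\<close> to apply pointwise, once the visit indicator has been replaced by its
  conditional probability under the integral.\<close>

lemma drift_event_contraction:
  fixes \<epsilon> :: real
  assumes i: "i \<in> {1..m}" "v \<in> V i" and "0 < \<epsilon>" and "N \<le> n"
  defines "e \<equiv> \<lambda>n. \<integral>\<omega>. indicator (drift_event i v ((1 + \<epsilon>)\<^sup>2) N n) \<omega>
                        * ((real (card (V i)) + real n) / (visits i v n \<omega> + \<epsilon>)) \<partial>M"
  shows "e (Suc n) \<le> (1 - \<epsilon> / (real (card (V i)) + real n)) * e n"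
proof -
  define A where "A = drift_event i v ((1 + \<epsilon>)\<^sup>2) N"
  define D where "D = real (card (V i)) + real n"
  define S where "S = visits i v n"
  \<comment> \<open>The change of the weight due to a visit at time \<open>n + 1\<close>, cut off to
    the event at time \<open>n\<close>. Both quotients lie between 0 and
    \<open>(D + 1) / \<epsilon>\<close>, which bounds \<open>f\<close>.\<close>
  define f where "f = (\<lambda>\<omega>. indicator (A n) \<omega> * ((D + 1) / (S \<omega> + 1 + \<epsilon>) - (D + 1) / (S \<omega> + \<epsilon>)))"
  have "0 < D" using card_V_pos[OF i(1)] by (simp add: D_def)
  have S_nonneg: "0 \<le> S \<omega>" for \<omega> by (simp add: S_def visits_nonneg)
  have A_filt [measurable]: "A n \<in> sets (filt n)" for n
    unfolding A_def by (rule drift_event_filt)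
  have A_M [measurable]: "A n \<in> sets M" for n
    using A_filt subalgebra_filt[of n] by (auto simp: subalgebra_def)
  have S_filt [measurable]: "S \<in> borel_measurable (filt n)"
    unfolding S_def using i by (intro visits_measurable_filt) auto
  have visits_M [measurable]: "visits i v n \<in> borel_measurable M" for n
    by (rule measurable_from_subalg[OF subalgebra_filt visits_measurable_filt[OF i order_refl]])
  have S_M [measurable]: "S \<in> borel_measurable M"
    unfolding S_def by measurable
  have f_filt: "f \<in> borel_measurable (filt n)"
    unfolding f_def by measurable
  have quot: "0 \<le> (D + 1) / (s + \<epsilon>) \<and> (D + 1) / (s + \<epsilon>) \<le> (D + 1) / \<epsilon>" if "0 \<le> s" for s
    using that \<open>0 < \<epsilon>\<close> \<open>0 < D\<close> by (auto intro!: divide_left_mono)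
  have f_bound: "\<bar>f \<omega>\<bar> \<le> (D + 1) / \<epsilon>" for \<omega>
    using quot[OF S_nonneg[of \<omega>]] quot[of "S \<omega> + 1"] S_nonneg[of \<omega>]
    by (auto simp: f_def indicator_def abs_le_iff)
  have int_quot: "integrable M (\<lambda>\<omega>. indicator B \<omega> * ((D + 1) / (visits i v k \<omega> + \<epsilon>)))"
    if [measurable]: "B \<in> sets M" for B k
  proof (rule integrable_const_bound[where B = "(D + 1) / \<epsilon>"])
    have "\<bar>indicator B \<omega> * ((D + 1) / (visits i v k \<omega> + \<epsilon>))\<bar> \<le> (D + 1) / \<epsilon>" for \<omega>
      using quot[OF visits_nonneg[of i v k \<omega>]] \<open>0 < \<epsilon>\<close> \<open>0 < D\<close>
      by (cases "\<omega> \<in> B") (auto simp del: abs_divide)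
    then show "AE \<omega> in M. norm (indicator B \<omega> * ((D + 1) / (visits i v k \<omega> + \<epsilon>))) \<le> (D + 1) / \<epsilon>"
      by simp
  qed measurable
  have int_D: "integrable M (\<lambda>\<omega>. indicator (A n) \<omega> * (D / (S \<omega> + \<epsilon>)))"
  proof -
    have "indicator (A n) \<omega> * (D / (S \<omega> + \<epsilon>))
        = D / (D + 1) * (indicator (A n) \<omega> * ((D + 1) / (visits i v n \<omega> + \<epsilon>)))" for \<omega>
      using \<open>0 < D\<close> by (simp add: S_def)
    then show ?thesis
      by (simp only: integrable_mult_right[OF int_quot[OF A_M]])
  qed
  note walk = integral_filt_walk[OF i f_filt f_bound]
  have "e (Suc n) = (\<integral>\<omega>. indicator (A (Suc n)) \<omega> * ((D + 1) / (visits i v (Suc n) \<omega> + \<epsilon>)) \<partial>M)"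
    by (simp add: e_def A_def D_def add_ac)
  \<comment> \<open>\<open>A (Suc n)\<close> also involves the position at time
    \<open>n + 1\<close>; enlarging it to \<open>A n\<close> leaves the visit itself as the only
    dependence on that step.\<close>
  also have "\<dots> \<le> (\<integral>\<omega>. indicator (A n) \<omega> * ((D + 1) / (visits i v (Suc n) \<omega> + \<epsilon>)) \<partial>M)"
  proof (rule integral_mono[OF int_quot[OF A_M] int_quot[OF A_M]])
    fix \<omega>
    have "indicator (A (Suc n)) \<omega> \<le> (indicator (A n) \<omega> :: real)"
      by (auto simp: A_def drift_event_def indicator_def)
    then show "indicator (A (Suc n)) \<omega> * ((D + 1) / (visits i v (Suc n) \<omega> + \<epsilon>))
        \<le> indicator (A n) \<omega> * ((D + 1) / (visits i v (Suc n) \<omega> + \<epsilon>))"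
      using quot[OF visits_nonneg] by (intro mult_right_mono) auto
  qed
  also have "\<dots> = (\<integral>\<omega>. indicator (A n) \<omega> * ((D + 1) / (S \<omega> + \<epsilon>)) + f \<omega> * of_bool (W i (Suc n) \<omega> = v) \<partial>M)"
    by (intro Bochner_Integration.integral_cong) (auto simp: visits_Suc f_def S_def indicator_def add_ac)
  also have "\<dots> = (\<integral>\<omega>. indicator (A n) \<omega> * ((D + 1) / (S \<omega> + \<epsilon>)) + f \<omega> * trans (occ n \<omega>) i v \<partial>M)"
    using int_quot[OF A_M[of n], of n] walk by (simp add: S_def)
  also have "\<dots> \<le> (\<integral>\<omega>. (1 - \<epsilon> / D) * (indicator (A n) \<omega> * (D / (S \<omega> + \<epsilon>))) \<partial>M)"
  proof (rule integral_mono)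
    show "integrable M (\<lambda>\<omega>. indicator (A n) \<omega> * ((D + 1) / (S \<omega> + \<epsilon>)) + f \<omega> * trans (occ n \<omega>) i v)"
      using int_quot[OF A_M[of n], of n] walk(2) by (simp add: S_def)
    show "integrable M (\<lambda>\<omega>. (1 - \<epsilon> / D) * (indicator (A n) \<omega> * (D / (S \<omega> + \<epsilon>))))"
      using int_D by (rule integrable_mult_right)
    fix \<omega>
    show "indicator (A n) \<omega> * ((D + 1) / (S \<omega> + \<epsilon>)) + f \<omega> * trans (occ n \<omega>) i v
        \<le> (1 - \<epsilon> / D) * (indicator (A n) \<omega> * (D / (S \<omega> + \<epsilon>)))"
    proof (cases "\<omega> \<in> A n")
      case True
      then have "(1 + \<epsilon>)\<^sup>2 * ((1 + S \<omega>) / D) \<le> trans (occ n \<omega>) i v"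
        using \<open>N \<le> n\<close> i by (auto simp: A_def drift_event_def occ_eq_visits S_def D_def)
      from visit_drift[OF \<open>0 < \<epsilon>\<close> \<open>0 < D\<close> S_nonneg this] True show ?thesis
        by (simp add: f_def)
    qed (simp add: f_def)
  qed
  also have "\<dots> = (1 - \<epsilon> / D) * e n"
    unfolding e_def A_def D_def S_def by (rule Bochner_Integration.integral_mult_right_zero)
  finally show ?thesis by (simp add: D_def)
qed

text \<open>At most \<open>n\<close> visits occur up to time \<open>n\<close>, so the weight is at
  least \<open>1 / (1 + \<epsilon>)\<close>. Hence the probability that the bound has held so far is
  at most \<open>1 + \<epsilon>\<close> times an expectation that tends to 0.\<close>

lemma prob_drift_forever:
  assumes i: "i \<in> {1..m}" "v \<in> V i" and "0 < \<epsilon>"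
  shows "(\<Inter>n. drift_event i v ((1 + \<epsilon>)\<^sup>2) N n) \<in> null_sets M"
proof -
  let ?A = "drift_event i v ((1 + \<epsilon>)\<^sup>2) N"
  let ?d = "real (card (V i))"
  define e where "e = (\<lambda>n. \<integral>\<omega>. indicator (?A n) \<omega> * ((?d + real n) / (visits i v n \<omega> + \<epsilon>)) \<partial>M)"
  have d: "1 \<le> ?d" using card_V_pos[OF i(1)] by simp
  have A_M [measurable]: "?A n \<in> sets M" for n
    using drift_event_filt subalgebra_filt[of n] by (auto simp: subalgebra_def)
  have visits_M [measurable]: "visits i v n \<in> borel_measurable M" for n
    by (rule measurable_from_subalg[OF subalgebra_filt visits_measurable_filt[OF i order_refl]])
  have "0 \<le> e n" for n
    unfolding e_def using visits_nonneg \<open>0 < \<epsilon>\<close> d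
    by (intro integral_nonneg_AE) (auto intro!: mult_nonneg_nonneg divide_nonneg_nonneg add_nonneg_nonneg)
  moreover have "e (Suc n) \<le> (1 - \<epsilon> / (?d + real n)) * e n" if "N \<le> n" for n
    unfolding e_def by (rule drift_event_contraction[OF i \<open>0 < \<epsilon>\<close> that])
  ultimately have e_lim: "e \<longlonglongrightarrow> 0"
    using \<open>0 < \<epsilon>\<close> d by (intro tendsto_0_of_harmonic_contraction[where d = ?d and \<epsilon> = \<epsilon> and N = N]) auto
  have lower: "prob (?A n) \<le> (1 + \<epsilon>) * e n" for n
  proof -
    have "prob (?A n) = (\<integral>\<omega>. indicator (?A n) \<omega> \<partial>M)"
      using sets.sets_into_space[OF A_M] by (simp add: Int_absorb2)
    also have "\<dots> \<le> (\<integral>\<omega>. (1 + \<epsilon>) * (indicator (?A n) \<omega> * ((?d + real n) / (visits i v n \<omega> + \<epsilon>))) \<partial>M)"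
    proof (rule integral_mono)
      show "integrable M (\<lambda>\<omega>. (1 + \<epsilon>) * (indicator (?A n) \<omega> * ((?d + real n) / (visits i v n \<omega> + \<epsilon>))))"
      proof (intro integrable_mult_right integrable_const_bound[where B = "(?d + real n) / \<epsilon>"])
        have "\<bar>indicator (?A n) \<omega> * ((?d + real n) / (visits i v n \<omega> + \<epsilon>))\<bar> \<le> (?d + real n) / \<epsilon>" for \<omega>
          using visits_nonneg[of i v n \<omega>] \<open>0 < \<epsilon>\<close> d
          by (auto simp: indicator_def intro!: divide_left_mono)
        then show "AE \<omega> in M. norm (indicator (?A n) \<omega> * ((?d + real n) / (visits i v n \<omega> + \<epsilon>))) \<le> (?d + real n) / \<epsilon>"
          by simp
      qed measurable
      fix \<omega>
      \<comment> \<open>The second term uses \<open>1 \<le> ?d\<close>, that is, that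
        \<open>V i\<close> is nonempty.\<close>
      have "visits i v n \<omega> + \<epsilon> \<le> (?d + real n) + \<epsilon> * (?d + real n)"
        using visits_le[of i v n \<omega>] d \<open>0 < \<epsilon>\<close> mult_left_mono[of 1 "?d + real n" \<epsilon>] by linarith
      then have "1 \<le> (1 + \<epsilon>) * ((?d + real n) / (visits i v n \<omega> + \<epsilon>))"
        using visits_nonneg[of i v n \<omega>] \<open>0 < \<epsilon>\<close> by (simp add: field_simps)
      then show "indicator (?A n) \<omega> \<le> (1 + \<epsilon>) * (indicator (?A n) \<omega> * ((?d + real n) / (visits i v n \<omega> + \<epsilon>)))"
        by (simp add: indicator_def)
    qed (simp add: less_top[symmetric])
    also have "\<dots> = (1 + \<epsilon>) * e n"
      unfolding e_def by (rule Bochner_Integration.integral_mult_right_zero)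
    finally show ?thesis .
  qed
  have "(\<lambda>n. (1 + \<epsilon>) * e n) \<longlonglongrightarrow> 0"
    using e_lim by (rule tendsto_mult_right_zero)
  moreover have "prob (\<Inter>n. ?A n) \<le> (1 + \<epsilon>) * e n" for n
    using finite_measure_mono[of "\<Inter>n. ?A n" "?A n"] lower[of n] by (auto intro: order_trans)
  ultimately have "prob (\<Inter>n. ?A n) \<le> 0"
    by (intro LIMSEQ_le_const) auto
  then show ?thesis
    by (auto simp: null_sets_def emeasure_eq_measure measure_le_0_iff)
qed

section \<open>The event of convergence to \<open>p\<close>\<close>

text \<open>Outside the finite index set both \<open>occ n \<omega>\<close> and \<open>p\<close>
  vanish, so only finitely many coordinates matter. This gives measurability even if the type
  \<open>'v\<close> is uncountable.\<close>

lemma occ_limit_event: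
  assumes "p \<in> domain_D m V"
  shows "{\<omega> \<in> space M. (\<lambda>n. occ n \<omega>) \<longlonglongrightarrow> p} \<in> sets M"
proof -
  have occ_M: "(\<lambda>\<omega>. occ n \<omega> i v) \<in> borel_measurable M" for n i v
    by (rule measurable_from_subalg[OF subalgebra_filt occ_measurable_filt[OF order_refl]])
  have "(\<lambda>n. occ n \<omega>) \<longlonglongrightarrow> p \<longleftrightarrow> (\<forall>i\<in>{1..m}. \<forall>v\<in>V i. (\<lambda>n. occ n \<omega> i v) \<longlonglongrightarrow> p i v)" for \<omega>
  proof -
    have "(\<lambda>n. occ n \<omega> i v) \<longlonglongrightarrow> p i v" if out: "\<not> (i \<in> {1..m} \<and> v \<in> V i)" for i v
    proof -
      have "p i v = 0" using assms out unfolding domain_D_def by blast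
      then show ?thesis by (simp only: occ_outside[OF out] tendsto_const)
    qed
    then show ?thesis
      unfolding tendsto_fun_iff by blast
  qed
  then have "{\<omega> \<in> space M. (\<lambda>n. occ n \<omega>) \<longlonglongrightarrow> p}
      = {\<omega> \<in> space M. \<forall>i\<in>{1..m}. \<forall>v\<in>V i. (\<lambda>n. occ n \<omega> i v) \<longlonglongrightarrow> p i v}"
    by simp
  also have "\<dots> \<in> sets M"
    using finite_V occ_M by (intro sets.sets_Collect_finite_All sets_Collect_LIMSEQ_real) auto
  finally show ?thesis .
qed

text \<open>Along a path converging to \<open>p\<close> the quotients tend to \<open>L\<close>,
  hence eventually exceed \<open>c\<close>. The time from which they do depends on the path, which
  accounts for the union over \<open>N\<close>.\<close>

lemma occ_limit_subset_drift_forever: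
  assumes i: "i \<in> {1..m}" "v \<in> V i" and "p i v = 0" and "c < L"
    and lim: "((\<lambda>x. trans x i v / x i v) \<longlongrightarrow> L) (at p within {x \<in> domain_D m V. 0 < x i v})"
  shows "{\<omega> \<in> space M. (\<lambda>n. occ n \<omega>) \<longlonglongrightarrow> p} \<subseteq> (\<Union>N. \<Inter>n. drift_event i v c N n)"
proof
  fix \<omega> assume "\<omega> \<in> {\<omega> \<in> space M. (\<lambda>n. occ n \<omega>) \<longlonglongrightarrow> p}"
  then have \<omega>: "\<omega> \<in> space M" and conv: "(\<lambda>n. occ n \<omega>) \<longlonglongrightarrow> p" by auto
  \<comment> \<open>The filter \<open>at p within\<close> excludes \<open>p\<close> itself, so the
    path must avoid \<open>p\<close>; it does because coordinate \<open>(i, v)\<close> is positive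
    along it.\<close>
  have "occ n \<omega> \<noteq> p" for n
    using occ_pos[OF i, of n \<omega>] \<open>p i v = 0\<close> by auto
  then have "filterlim (\<lambda>n. occ n \<omega>) (at p within {x \<in> domain_D m V. 0 < x i v}) sequentially"
    using conv occ_in_domain[OF \<omega>] occ_pos[OF i] by (simp add: filterlim_at)
  from filterlim_compose[OF lim this]
  have "(\<lambda>n. trans (occ n \<omega>) i v / occ n \<omega> i v) \<longlonglongrightarrow> L" .
  then have "\<forall>\<^sub>F n in sequentially. c < trans (occ n \<omega>) i v / occ n \<omega> i v"
    using \<open>c < L\<close> by (rule order_tendstoD)
  then obtain N where N: "\<And>n. N \<le> n \<Longrightarrow> c < trans (occ n \<omega>) i v / occ n \<omega> i v"
    by (auto simp: eventually_sequentially)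
  have "c * occ n \<omega> i v \<le> trans (occ n \<omega>) i v" if "N \<le> n" for n
    using N[OF that] occ_pos[OF i, of n \<omega>] by (simp add: pos_less_divide_eq)
  with \<omega> have "\<omega> \<in> drift_event i v c N n" for n
    by (simp add: drift_event_def)
  then show "\<omega> \<in> (\<Union>N. \<Inter>n. drift_event i v c N n)"
    by blast
qed

end


theorem theorem2:
  fixes M :: "'w measure"
    and m :: nat
    and V :: "nat \<Rightarrow> 'v set"
    and \<alpha> L :: real
    and \<eta> :: "nat \<Rightarrow> 'v \<Rightarrow> real"
    and \<rho> :: "nat \<Rightarrow> nat \<Rightarrow> 'v \<Rightarrow> real"
    and W :: "nat \<Rightarrow> nat \<Rightarrow> 'w \<Rightarrow> 'v"
    and p :: "nat \<Rightarrow> 'v \<Rightarrow> real"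
    and i :: nat
    and k :: 'v
  assumes "interacting_walks M m V \<alpha> \<eta> \<rho> W"
    and "p \<in> boundary_D m V"
    and "i \<in> {1..m}"
    and "k \<in> V i"
    and "p i k = 0"
    and "((\<lambda>x. trans_pi m V \<alpha> \<eta> \<rho> x i k / x i k) \<longlongrightarrow> L) (at p within {x \<in> domain_D m V. 0 < x i k})"
    and "1 < L"
  shows "{\<omega> \<in> space M. (\<lambda>n. occupation m V W n \<omega>) \<longlonglongrightarrow> p} \<in> sets M \<and>
         measure M {\<omega> \<in> space M. (\<lambda>n. occupation m V W n \<omega>) \<longlonglongrightarrow> p} = 0"
proof -
  interpret interacting_walks M m V \<alpha> \<eta> \<rho> W by fact
  let ?E = "{\<omega> \<in> space M. (\<lambda>n. occupation m V W n \<omega>) \<longlonglongrightarrow> p}"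
  \<comment> \<open>Since \<open>1 < L\<close>, continuity at 0 provides a positive
    \<open>\<epsilon>\<close> whose constant \<open>(1 + \<epsilon>)\<^sup>2\<close> still lies
    strictly below \<open>L\<close>.\<close>
  have "((\<lambda>\<epsilon>::real. (1 + \<epsilon>)\<^sup>2) \<longlongrightarrow> (1 + 0)\<^sup>2) (at_right 0)"
    by (intro tendsto_intros)
  then have "\<forall>\<^sub>F \<epsilon> in at_right 0. (1 + \<epsilon>)\<^sup>2 < L"
    using \<open>1 < L\<close> by (intro order_tendstoD) auto
  then have "\<forall>\<^sub>F \<epsilon> in at_right 0. (1 + \<epsilon>)\<^sup>2 < L \<and> 0 < \<epsilon>"
    by (intro eventually_conj eventually_at_right_less)
  then obtain \<epsilon> where \<epsilon>: "(1 + \<epsilon>)\<^sup>2 < L" "0 < \<epsilon>"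
    using eventually_happens'[OF trivial_limit_at_right_real] by blast
  have "p \<in> domain_D m V"
    using assms(2) by (simp add: boundary_D_def)
  then have E: "?E \<in> sets M"
    by (rule occ_limit_event)
  have "(\<Union>N. \<Inter>n. drift_event i k ((1 + \<epsilon>)\<^sup>2) N n) \<in> null_sets M"
    by (intro null_sets_UN prob_drift_forever assms(3,4) \<epsilon>(2))
  then have "?E \<in> null_sets M"
    using E occ_limit_subset_drift_forever[OF assms(3,4,5) \<epsilon>(1) assms(6)]
    by (rule null_sets_subset)
  then show ?thesis
    using E by (simp add: null_sets_def measure_def)
qed

end
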